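(* Let $T$ be a compact contraction on $H$ with $\|T\|=1$ and $\Gamma_p(T)=\emptyset$, and let $S$ be a compact contraction on $H$. Then $S$ is Harnack equivalent to $T$ in $C_1(H)$ if and only if $\ker(I-T^*T)=\ker(I-S^*S)=:E$ and $T|_E=S|_E$.
   Context: $H$ is a complex Hilbert space; $\mathbb{D}$ is the open unit disc and $\mathbb{T}$ the unit circle. $C_1(H)$ is the set of all contractions on $H$ (bounded operators with $\|T\|\le 1$). For $T\in C_1(H)$ and $z\in\mathbb{D}$, put $K_z(T)=(I-\overline{z}T)^{-1}+(I-zT^* )^{-1}-I$. For $T_0,T_1\in C_1(H)$, $T_1$ is Harnack dominated by $T_0$ if there is a constant $c\ge 1$ with $K_z(T_1)\le c^2K_z(T_0)$ for all $z\in\mathbb{D}$; they are Harnack equivalent if each is Harnack dominated by the other. $\Gamma_p(T)=\sigma_p(T)\cap\mathbb{T}$, where $\sigma_p(T)$ is the point spectrum of $T$. *)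

theory Defs
  imports "HOL-Analysis.Analysis" "HOL-Library.Nonpos_Ints"
begin

text \<open>
  Complex inner product spaces are set up on top of the library's real inner product spaces:
  the real inner product is the real part of the complex one, which is linear in its
  first argument. Positive definiteness and \<open>(norm x)\<^sup>2 = cinner x x\<close> are
  inherited: \<open>cinner x x\<close> is real by \<open>cinner_commute\<close>, hence equal to \<open>inner x x\<close>.
\<close>

class complex_inner = real_inner +
  fixes scaleC :: "complex \<Rightarrow> 'a \<Rightarrow> 'a"  (infixr "*\<^sub>C" 75)
    and cinner :: "'a \<Rightarrow> 'a \<Rightarrow> complex"
  assumes scaleC_add_right: "a *\<^sub>C (x + y) = a *\<^sub>C x + a *\<^sub>C y"
    and scaleC_add_left: "(a + b) *\<^sub>C x = a *\<^sub>C x + b *\<^sub>C x"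
    and scaleC_scaleC: "a *\<^sub>C b *\<^sub>C x = (a * b) *\<^sub>C x"
    and scaleC_of_real: "complex_of_real r *\<^sub>C x = r *\<^sub>R x"
    and cinner_commute: "cinner x y = cnj (cinner y x)"
    and cinner_add_left: "cinner (x + y) z = cinner x z + cinner y z"
    and cinner_scaleC_left: "cinner (a *\<^sub>C x) y = a * cinner x y"
    and Re_cinner: "Re (cinner x y) = inner x y"

class complex_hilbert = complex_inner + complete_space

definition bounded_clinear :: "('a::complex_inner \<Rightarrow> 'b::complex_inner) \<Rightarrow> bool" where
  "bounded_clinear T \<longleftrightarrow> bounded_linear T \<and> (\<forall>c x. T (c *\<^sub>C x) = c *\<^sub>C T x)"

definition contractions :: "('a::complex_hilbert \<Rightarrow> 'a) set" where
  "contractions = {T. bounded_clinear T \<and> onorm T \<le> 1}"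

definition compact_operator :: "('a::complex_hilbert \<Rightarrow> 'a) \<Rightarrow> bool" where
  "compact_operator T \<longleftrightarrow> bounded_clinear T \<and> compact (closure (T ` cball 0 1))"

text \<open>
  For bounded operators on a Hilbert space the adjoint exists and is unique, so the
  description below is proper; it is unspecified otherwise.
\<close>

definition cadjoint :: "('a::complex_hilbert \<Rightarrow> 'a) \<Rightarrow> 'a \<Rightarrow> 'a" where
  "cadjoint T = (THE S. \<forall>x y. cinner (T x) y = cinner x (S y))"

definition op_kernel :: "('a::complex_hilbert \<Rightarrow> 'a) \<Rightarrow> 'a set" where
  "op_kernel A = {x. A x = 0}"

definition point_spectrum :: "('a::complex_hilbert \<Rightarrow> 'a) \<Rightarrow> complex set" where
  "point_spectrum T = {\<mu>. \<exists>x. x \<noteq> 0 \<and> T x = \<mu> *\<^sub>C x}"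

definition Gamma_p :: "('a::complex_hilbert \<Rightarrow> 'a) \<Rightarrow> complex set" where
  "Gamma_p T = point_spectrum T \<inter> sphere 0 1"

definition op_le :: "('a::complex_hilbert \<Rightarrow> 'a) \<Rightarrow> ('a \<Rightarrow> 'a) \<Rightarrow> bool" where
  "op_le A B \<longleftrightarrow> (\<forall>x. cinner (B x - A x) x \<in> \<real>\<^sub>\<ge>\<^sub>0)"

text \<open>
  The inverses are inverse functions; for a contraction \<open>T\<close> and \<open>norm z < 1\<close>
  both operators being inverted are bijections.
\<close>

definition harnack_kernel :: "complex \<Rightarrow> ('a::complex_hilbert \<Rightarrow> 'a) \<Rightarrow> 'a \<Rightarrow> 'a" where
  "harnack_kernel z T =
     (\<lambda>x. inv (\<lambda>y. y - cnj z *\<^sub>C T y) x + inv (\<lambda>y. y - z *\<^sub>C cadjoint T y) x - x)"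

definition harnack_dominated :: "('a::complex_hilbert \<Rightarrow> 'a) \<Rightarrow> ('a \<Rightarrow> 'a) \<Rightarrow> bool" where
  "harnack_dominated T1 T0 \<longleftrightarrow>
     (\<exists>c::real. c \<ge> 1 \<and> (\<forall>z\<in>ball 0 1.
        op_le (harnack_kernel z T1) (\<lambda>x. c\<^sup>2 *\<^sub>R harnack_kernel z T0 x)))"

definition harnack_equivalent :: "('a::complex_hilbert \<Rightarrow> 'a) \<Rightarrow> ('a \<Rightarrow> 'a) \<Rightarrow> bool" where
  "harnack_equivalent S T \<longleftrightarrow> harnack_dominated S T \<and> harnack_dominated T S"

end

theory Submission
  imports Defs
begin

text \<open>
  If \<open>x = y - cnj z *\<^sub>C T y\<close>, then \<open>K\<^sub>z(T)\<close> has the value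
  \<open>(norm y)\<^sup>2 - |z|\<^sup>2 * (norm (T y))\<^sup>2\<close> at \<open>x\<close>, so everything reduces to comparing defect forms
  along the resolvents. A compact contraction without unimodular eigenvalues has uniformly bounded
  resolvents on the disc, and \<open>E\<close> consists of the vectors whose norm \<open>T\<close> preserves.

  If \<open>S\<close> is dominated by \<open>T\<close> and \<open>e \<in> E\<close>, Parseval's identity on circles of radius tending to 1
  yields \<open>(norm e)\<^sup>2 + (norm (S e - T e))\<^sup>2 \<le> (norm (S e))\<^sup>2\<close>, whence \<open>S e = T e\<close> and \<open>S\<close> preserves
  the norm of \<open>e\<close>. Conversely, write \<open>y = e + f\<close> with \<open>e \<in> E\<close> and \<open>f\<close> orthogonal to \<open>E\<close>: the part \<open>e\<close>
  contributes \<open>(1 - |z|\<^sup>2) * (norm e)\<^sup>2\<close> to the forms of both \<open>S\<close> and \<open>T\<close>, while the form of \<open>T\<close> is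
  coercive in \<open>f\<close> by compactness and the remaining part for \<open>S\<close> is bounded by a multiple of \<open>norm f\<close>.
\<close>

section \<open>Complex inner product spaces\<close>

lemma
  fixes x :: "'a::complex_inner"
  shows scaleC_one: "1 *\<^sub>C x = x"
    and scaleC_scaleR: "a *\<^sub>C (r *\<^sub>R x) = r *\<^sub>R (a *\<^sub>C x)"
    and scaleR_scaleC: "(r *\<^sub>R a) *\<^sub>C x = r *\<^sub>R (a *\<^sub>C x)"
proof -
  show "1 *\<^sub>C x = x" using scaleC_of_real[of 1 x] by simp
  show "a *\<^sub>C (r *\<^sub>R x) = r *\<^sub>R (a *\<^sub>C x)"
    unfolding scaleC_of_real[symmetric] scaleC_scaleC by (simp add: mult.commute)
  show "(r *\<^sub>R a) *\<^sub>C x = r *\<^sub>R (a *\<^sub>C x)"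
    unfolding scaleC_of_real[symmetric] scaleC_scaleC by (simp add: scaleR_conv_of_real)
qed

lemma cinner_add_right: "cinner x (y + z) = cinner x y + cinner x z"
  by (metis cinner_add_left cinner_commute complex_cnj_add)

lemma cinner_scaleC_right: "cinner x (a *\<^sub>C y) = cnj a * cinner x y"
  by (metis cinner_commute cinner_scaleC_left complex_cnj_mult)

lemma cinner_self: "cinner x x = of_real ((norm x)\<^sup>2)"
proof (rule complex_eqI)
  show "Re (cinner x x) = Re (of_real ((norm x)\<^sup>2))"
    by (simp add: Re_cinner power2_norm_eq_inner)
  show "Im (cinner x x) = Im (of_real ((norm x)\<^sup>2))"
    using arg_cong[OF cinner_commute[of x x], of Im] by simp
qed

lemma norm_scaleC: "norm (a *\<^sub>C x) = cmod a * norm (x :: 'a::complex_inner)"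
proof -
  have "complex_of_real ((norm (a *\<^sub>C x))\<^sup>2) = of_real ((cmod a * norm x)\<^sup>2)"
    unfolding cinner_self[symmetric] cinner_scaleC_left cinner_scaleC_right power_mult_distrib
    by (simp add: cinner_self complex_norm_square[unfolded of_real_power] mult.commute flip: mult.assoc)
  then show ?thesis
    by (simp only: of_real_eq_iff) (simp add: power2_eq_iff_nonneg)
qed

interpretation scaleC: bounded_bilinear "scaleC :: complex \<Rightarrow> 'a::complex_inner \<Rightarrow> 'a"
  by unfold_locales
    (auto simp: scaleC_add_left scaleC_add_right scaleC_scaleR scaleR_scaleC norm_scaleC
      intro: exI[of _ 1])

interpretation cinner_left: additive "\<lambda>x. cinner x y" for y :: "'a::complex_inner"
  by unfold_locales (rule cinner_add_left)

interpretation cinner_right: additive "\<lambda>y. cinner x y" for x :: "'a::complex_inner"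
  by unfold_locales (rule cinner_add_right)

text \<open>Replacing \<open>x\<close> by \<open>(-\<i>) *\<^sub>C x\<close> turns the imaginary
  part into a real part, so for homogeneous \<open>f\<close> and \<open>g\<close> an identity of
  real inner products implies the complex one.\<close>

lemma cinner_eqI:
  assumes "\<And>x. inner (f x) y = inner (g x) z"
    and "\<And>c x. f (c *\<^sub>C x) = c *\<^sub>C f x" "\<And>c x. g (c *\<^sub>C x) = c *\<^sub>C g x"
  shows "cinner (f x) y = cinner (g x) (z :: 'a::complex_inner)"
proof (rule complex_eqI)
  show "Re (cinner (f x) y) = Re (cinner (g x) z)"
    using assms(1) by (simp add: Re_cinner)
  have "Re (cinner (f ((-\<i>) *\<^sub>C x)) y) = Re (cinner (g ((-\<i>) *\<^sub>C x)) z)"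
    using assms(1) by (simp only: Re_cinner)
  then show "Im (cinner (f x) y) = Im (cinner (g x) z)"
    unfolding assms(2,3) cinner_scaleC_left by simp
qed

section \<open>Parallelogram law and discrete Parseval identity\<close>

lemma parallelogram:
  fixes a b :: "'a::real_inner"
  shows "(norm (a + b))\<^sup>2 + (norm (a - b))\<^sup>2 = 2 * (norm a)\<^sup>2 + 2 * (norm b)\<^sup>2"
  by (simp add: power2_norm_eq_inner inner_simps inner_commute)

text \<open>The characters of Z/n are orthogonal, so summing over the n-th roots of unity cancels
  the mixed terms of the expanded squares. This finite sum replaces an integral over the
  circle.\<close>

lemma sum_roots_of_unity_Parseval:
  fixes v :: "nat \<Rightarrow> 'a::complex_inner"
  assumes "n > 0"
  shows "(\<Sum>k<n. (norm (\<Sum>j<n. (cis (2 * pi * real k / real n)) ^ j *\<^sub>C v j))\<^sup>2)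
    = n * (\<Sum>j<n. (norm (v j))\<^sup>2)"
proof -
  define \<zeta> where "\<zeta> = cis (2 * pi / real n)"
  have pow: "\<zeta> ^ k = cis (2 * pi * real k / real n)" for k
    by (simp add: \<zeta>_def Complex.DeMoivre mult_ac)
  have nz: "\<zeta> \<noteq> 0" by (simp add: \<zeta>_def)
  have cn: "cnj \<zeta> = inverse \<zeta>" by (simp add: \<zeta>_def cis_cnj)
  have orth: "(\<Sum>k<n. (\<zeta> ^ k) ^ i * cnj ((\<zeta> ^ k) ^ j)) = (if i = j then of_nat n else 0)"
    if "i < n" "j < n" for i j
  proof -
    \<comment> \<open>The sum is geometric with ratio \<open>a\<close>, an n-th root of unity. It
      vanishes unless \<open>a = 1\<close>, and this means \<open>i = j\<close> because both indices
      are below \<open>n\<close>.\<close>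
    define a where "a = \<zeta> ^ i * cnj (\<zeta> ^ j)"
    have "(\<Sum>k<n. (\<zeta> ^ k) ^ i * cnj ((\<zeta> ^ k) ^ j)) = (\<Sum>k<n. a ^ k)"
      by (simp add: a_def power_mult_distrib flip: power_mult) (simp add: mult.commute)
    moreover have "a = 1 \<longleftrightarrow> i = j"
    proof -
      have "a = 1 \<longleftrightarrow> \<zeta> ^ i = \<zeta> ^ j"
        using nz by (simp add: a_def cn field_simps)
      also have "\<dots> \<longleftrightarrow> i = j"
        using bij_betw_imp_inj_on[OF Complex.bij_betw_roots_unity[OF assms]] that
        unfolding pow by (auto simp: inj_on_def)
      finally show ?thesis .
    qed
    moreover have "a ^ n = 1"
    proof -
      have "\<zeta> ^ n = 1" using assms pow[of n] by simp
      then show ?thesis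
        unfolding a_def power_mult_distrib complex_cnj_power[symmetric]
        by (metis complex_cnj_one mult_1 power_mult power_one mult.commute)
    qed
    ultimately show ?thesis
      using geometric_sum[of a n] by (auto simp: geometric_sum)
  qed
  have "complex_of_real (\<Sum>k<n. (norm (\<Sum>j<n. (\<zeta> ^ k) ^ j *\<^sub>C v j))\<^sup>2)
    = (\<Sum>k<n. \<Sum>i<n. \<Sum>j<n. (\<zeta> ^ k) ^ i * cnj ((\<zeta> ^ k) ^ j) * cinner (v i) (v j))"
    unfolding of_real_sum cinner_self[symmetric] cinner_left.sum cinner_right.sum
      cinner_scaleC_left cinner_scaleC_right sum_distrib_left
    by (subst (2) sum.swap) (simp add: mult_ac)
  also have "\<dots> = (\<Sum>i<n. \<Sum>j<n. (\<Sum>k<n. (\<zeta> ^ k) ^ i * cnj ((\<zeta> ^ k) ^ j)) * cinner (v i) (v j))"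
    unfolding sum_distrib_right
    by (subst sum.swap, rule sum.cong[OF refl], subst sum.swap, rule refl)
  also have "\<dots> = (\<Sum>i<n. \<Sum>j<n. if i = j then of_nat n * cinner (v i) (v j) else 0)"
    by (intro sum.cong refl) (auto simp: orth simp del: complex_cnj_power)
  also have "\<dots> = of_real (n * (\<Sum>j<n. (norm (v j))\<^sup>2))"
    by (simp add: cinner_self sum_distrib_left)
  finally show ?thesis
    unfolding pow of_real_eq_iff .
qed

section \<open>Orthogonal projections and adjoints\<close>

text \<open>By the parallelogram law a minimizing sequence for the distance to \<open>V\<close> is
  Cauchy. Its limit is a nearest point, and minimality forces orthogonality.\<close>

lemma orthogonal_projection_exists:
  fixes V :: "'a::{real_inner, complete_space} set"
  assumes "closed V" "subspace V"
  obtains p where "p \<in> V" "\<And>v. v \<in> V \<Longrightarrow> inner (x - p) v = 0"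
proof -
  have ne: "V \<noteq> {}" using subspace_0[OF assms(2)] by auto
  define d where "d = infdist x V"
  have d0: "d \<ge> 0" by (simp add: d_def infdist_nonneg)
  have d_le: "d \<le> norm (x - v)" if "v \<in> V" for v
    using infdist_le[OF that, of x] by (simp add: d_def dist_norm)
  \<comment> \<open>The slack is put on the squared distance, the quantity that enters the
    parallelogram law.\<close>
  have "\<exists>v\<in>V. (norm (x - v))\<^sup>2 < d\<^sup>2 + inverse (real (Suc n))" for n
  proof (rule ccontr)
    assume "\<not> ?thesis"
    then have "sqrt (d\<^sup>2 + inverse (real (Suc n))) \<le> dist x v" if "v \<in> V" for v
      using that by (auto simp: dist_norm not_less real_le_lsqrt)
    then have "sqrt (d\<^sup>2 + inverse (real (Suc n))) \<le> d"
      unfolding d_def infdist_def using ne by (auto intro!: cINF_greatest)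
    then have "d\<^sup>2 + inverse (real (Suc n)) \<le> d\<^sup>2"
      by (rule sqrt_le_D)
    then show False by (simp add: field_simps)
  qed
  then obtain v where v: "\<And>n. v n \<in> V" "\<And>n. (norm (x - v n))\<^sup>2 < d\<^sup>2 + inverse (real (Suc n))"
    by metis
  have close: "(dist (v m) (v n))\<^sup>2 \<le> 2 * inverse (real (Suc m)) + 2 * inverse (real (Suc n))" for m n
  proof -
    have "(1/2) *\<^sub>R (v m + v n) \<in> V"
      using v assms(2) by (simp add: subspace_add subspace_scale)
    then have "d \<le> norm (x - (1/2) *\<^sub>R (v m + v n))" by (rule d_le)
    then have "2 * d \<le> norm (2 *\<^sub>R (x - (1/2) *\<^sub>R (v m + v n)))" by simp
    also have "2 *\<^sub>R (x - (1/2) *\<^sub>R (v m + v n)) = (x - v m) + (x - v n)"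
      by (simp add: algebra_simps scaleR_2)
    finally have "(2 * d)\<^sup>2 \<le> (norm ((x - v m) + (x - v n)))\<^sup>2"
      using d0 by (intro power_mono) auto
    moreover have "dist (v m) (v n) = norm ((x - v m) - (x - v n))"
      by (simp add: dist_norm norm_minus_commute)
    ultimately show ?thesis
      using parallelogram[of "x - v m" "x - v n"] v(2)[of m] v(2)[of n]
      by (simp add: power_mult_distrib)
  qed
  have "Cauchy v"
  proof (rule metric_CauchyI)
    fix e :: real assume e: "e > 0"
    obtain N where N: "inverse (real (Suc N)) < e\<^sup>2 / 4"
      using reals_Archimedean[of "e\<^sup>2 / 4"] e by auto
    have "dist (v m) (v n) < e" if "m \<ge> N" "n \<ge> N" for m n
    proof -
      have "inverse (real (Suc m)) \<le> inverse (real (Suc N))" "inverse (real (Suc n)) \<le> inverse (real (Suc N))"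
        using that by (auto simp: field_simps)
      then have "(dist (v m) (v n))\<^sup>2 < e\<^sup>2"
        using close[of m n] N by linarith
      then show ?thesis
        using e by (simp add: power2_less_imp_less)
    qed
    then show "\<exists>M. \<forall>m\<ge>M. \<forall>n\<ge>M. dist (v m) (v n) < e" by blast
  qed
  then obtain p where p: "v \<longlonglongrightarrow> p"
    by (meson Cauchy_convergent convergent_def)
  have pV: "p \<in> V"
    using assms(1) v(1) p by (metis closed_sequentially)
  have "(norm (x - p))\<^sup>2 \<le> d\<^sup>2 + 0"
  proof (rule LIMSEQ_le)
    show "(\<lambda>n. (norm (x - v n))\<^sup>2) \<longlonglongrightarrow> (norm (x - p))\<^sup>2" by (intro tendsto_intros p)
    show "(\<lambda>n. d\<^sup>2 + inverse (real (Suc n))) \<longlonglongrightarrow> d\<^sup>2 + 0"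
      by (intro tendsto_intros LIMSEQ_inverse_real_of_nat)
    show "\<exists>N. \<forall>n\<ge>N. (norm (x - v n))\<^sup>2 \<le> d\<^sup>2 + inverse (real (Suc n))"
      using v(2) by (meson less_imp_le)
  qed
  then have p_min: "norm (x - p) \<le> d"
    using power2_le_imp_le[OF _ d0] by simp
  have "inner (x - p) w = 0" if "w \<in> V" for w
  proof (cases "w = 0")
    case False
    \<comment> \<open>This \<open>t\<close> minimizes the norm of
      \<open>x - p - t *\<^sub>R w\<close>, so any nonzero inner product would give a point of
      \<open>V\<close> nearer than \<open>p\<close>.\<close>
    define t where "t = inner (x - p) w / inner w w"
    have "p + t *\<^sub>R w \<in> V" using pV that assms(2) by (simp add: subspace_add subspace_scale)
    then have "norm (x - p) \<le> norm (x - (p + t *\<^sub>R w))" using d_le p_min order_trans by blast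
    then have "inner (x - p) (x - p) \<le> inner (x - p - t *\<^sub>R w) (x - p - t *\<^sub>R w)"
      by (simp only: norm_le diff_diff_add)
    also have "\<dots> = inner (x - p) (x - p) - 2 * t * inner (x - p) w + t * t * inner w w"
      unfolding inner_diff_left[of "x - p" "t *\<^sub>R w"] inner_diff_right[of _ "x - p" "t *\<^sub>R w"]
      using inner_commute[of w "x - p"] by simp
    also have "\<dots> = inner (x - p) (x - p) - (inner (x - p) w)\<^sup>2 / inner w w"
      using False by (simp add: t_def field_simps power2_eq_square)
    finally have "(inner (x - p) w)\<^sup>2 / inner w w \<le> 0" by simp
    moreover have "inner w w > 0" using False by simp
    ultimately show ?thesis by (simp add: divide_le_0_iff)
  qed simp
  with pV that show thesis by blast
qed

text \<open>A vector \<open>n\<close> orthogonal to the closed kernel of \<open>f\<close> represents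
  \<open>f\<close> after scaling, since \<open>x - (f x / f n) *\<^sub>R n\<close> always lies in
  that kernel.\<close>

lemma Riesz_representation:
  fixes f :: "'a::{real_inner, complete_space} \<Rightarrow> real"
  assumes "bounded_linear f"
  obtains v where "\<And>x. f x = inner x v"
proof (cases "\<forall>x. f x = 0")
  case True
  then show thesis using that[of 0] by simp
next
  case False
  interpret f: bounded_linear f by fact
  obtain a where a: "f a \<noteq> 0" using False by blast
  have "closed {x. f x = 0}"
    by (intro closed_Collect_eq continuous_intros f.continuous_on)
  moreover have "subspace {x. f x = 0}"
    by (auto simp: subspace_def f.add f.scaleR f.zero)
  ultimately obtain p where p: "f p = 0" "\<And>v. f v = 0 \<Longrightarrow> inner (a - p) v = 0"
    by (rule orthogonal_projection_exists[of "{x. f x = 0}" a]) auto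
  define n where "n = a - p"
  have fn: "f n \<noteq> 0" using a p by (simp add: n_def f.diff)
  then have nn: "inner n n \<noteq> 0" using f.zero by auto
  have "f x = inner x ((f n / inner n n) *\<^sub>R n)" for x
  proof -
    have "inner n (x - (f x / f n) *\<^sub>R n) = 0"
      unfolding n_def[symmetric] by (rule p(2)[folded n_def]) (use fn in \<open>simp add: f.diff f.scaleR\<close>)
    then show ?thesis using fn nn by (simp add: inner_diff_right inner_commute field_simps)
  qed
  then show thesis by (rule that)
qed

section \<open>Adjoints and defects of contractions\<close>

lemma bounded_clinearD:
  assumes "bounded_clinear T"
  shows "bounded_linear T" "T (c *\<^sub>C x) = c *\<^sub>C T x"
  using assms by (auto simp: bounded_clinear_def)

text \<open>This makes the description in \<open>cadjoint\<close> proper. Real Riesz representation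
  gives existence, \<open>cinner_eqI\<close> lifts it to the complex inner product, and real parts
  already determine the adjoint.\<close>

lemma cinner_cadjoint:
  fixes T :: "'a::complex_hilbert \<Rightarrow> 'a"
  assumes "bounded_clinear T"
  shows "cinner (T x) y = cinner x (cadjoint T y)"
proof -
  have "\<exists>v. \<forall>x. inner (T x) y = inner x v" for y
  proof -
    have "bounded_linear (\<lambda>x. inner (T x) y)"
      using bounded_linear_compose[OF bounded_linear_inner_left bounded_clinearD(1)[OF assms]] .
    then obtain v where "\<And>x. inner (T x) y = inner x v"
      using Riesz_representation by blast
    then show ?thesis by blast
  qed
  then obtain S where S: "\<And>x y. inner (T x) y = inner x (S y)" by metis
  have "\<exists>!S. \<forall>x y. cinner (T x) y = cinner x (S y)"
  proof (rule ex1I)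
    show "\<forall>x y. cinner (T x) y = cinner x (S y)"
      using cinner_eqI[of T _ "\<lambda>x. x"] S bounded_clinearD(2)[OF assms] by metis
    fix S' assume S': "\<forall>x y. cinner (T x) y = cinner x (S' y)"
    have "inner x (S' y) = inner x (S y)" for x y
      using S[of x y] S' Re_cinner by metis
    then show "S' = S" by (metis ext vector_eq_ldot)
  qed
  from theI'[OF this] show ?thesis unfolding cadjoint_def by blast
qed

lemma contractionsD:
  assumes "T \<in> contractions"
  shows "bounded_clinear T" "norm (T x) \<le> norm x"
proof -
  show "bounded_clinear T" using assms by (simp add: contractions_def)
  then have "norm (T x) \<le> onorm T * norm x"
    by (intro onorm bounded_clinearD)
  also have "\<dots> \<le> 1 * norm x"
    using assms by (intro mult_right_mono) (auto simp: contractions_def)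
  finally show "norm (T x) \<le> norm x" by simp
qed

lemma inner_cadjoint:
  assumes "T \<in> contractions"
  shows "inner (T x) y = inner x (cadjoint T y)"
  using cinner_cadjoint[OF contractionsD(1)[OF assms]] Re_cinner by metis

lemma cadjoint_contraction:
  assumes T: "T \<in> contractions"
  shows "cadjoint T \<in> contractions"
proof -
  note adj = cinner_cadjoint[OF contractionsD(1)[OF T], symmetric]
  have eqI: "a = b" if "\<And>x. cinner x a = cinner x b" for a b :: 'a
    using that by (metis Re_cinner vector_eq_ldot)
  have add: "cadjoint T (x + y) = cadjoint T x + cadjoint T y" for x y
    by (rule eqI) (simp add: adj cinner_add_right)
  have scale: "cadjoint T (c *\<^sub>C x) = c *\<^sub>C cadjoint T x" for c x
    by (rule eqI) (simp add: adj cinner_scaleC_right)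
  have scaleR: "cadjoint T (r *\<^sub>R x) = r *\<^sub>R cadjoint T x" for r x
    unfolding scaleC_of_real[symmetric] by (rule scale)
  have le: "norm (cadjoint T y) \<le> norm y" for y
  proof -
    have "(norm (cadjoint T y))\<^sup>2 = inner (T (cadjoint T y)) y"
      by (simp add: inner_cadjoint[OF T] power2_norm_eq_inner)
    also have "\<dots> \<le> norm (T (cadjoint T y)) * norm y"
      by (rule norm_cauchy_schwarz)
    also have "\<dots> \<le> norm (cadjoint T y) * norm y"
      by (intro mult_right_mono contractionsD(2)[OF T]) auto
    finally show ?thesis
      by (cases "cadjoint T y = 0") (simp_all add: power2_eq_square)
  qed
  have "bounded_linear (cadjoint T)"
    by (rule bounded_linear_intro[where K=1]) (use add scaleR le in auto)
  moreover have "onorm (cadjoint T) \<le> 1"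
    using onorm_bound[of 1 "cadjoint T"] le by simp
  ultimately show ?thesis
    using scale by (simp add: contractions_def bounded_clinear_def)
qed

text \<open>In the expanded square the cross term is \<open>-2 * (norm (T x))\<^sup>2\<close>, and
  the last term is at most \<open>(norm (T x))\<^sup>2\<close> because the adjoint is a contraction.
  Thus a small defect form makes \<open>x\<close> almost fixed by \<open>cadjoint T\<close> after
  \<open>T\<close>.\<close>

lemma norm_defect_le:
  assumes T: "T \<in> contractions"
  shows "(norm (x - cadjoint T (T x)))\<^sup>2 \<le> (norm x)\<^sup>2 - (norm (T x))\<^sup>2"
proof -
  have "(norm (x - cadjoint T (T x)))\<^sup>2
      = (norm x)\<^sup>2 - 2 * inner x (cadjoint T (T x)) + (norm (cadjoint T (T x)))\<^sup>2"
    by (simp add: power2_norm_eq_inner inner_diff_left inner_diff_right inner_commute)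
  also have "inner x (cadjoint T (T x)) = (norm (T x))\<^sup>2"
    by (simp add: power2_norm_eq_inner flip: inner_cadjoint[OF T])
  also have "(norm (cadjoint T (T x)))\<^sup>2 \<le> (norm (T x))\<^sup>2"
    by (intro power_mono contractionsD(2) cadjoint_contraction T) auto
  finally show ?thesis by simp
qed

lemma op_kernel_defect:
  assumes T: "T \<in> contractions"
  shows "x \<in> op_kernel (\<lambda>x. x - cadjoint T (T x)) \<longleftrightarrow> norm (T x) = norm x"
proof
  assume "x \<in> op_kernel (\<lambda>x. x - cadjoint T (T x))"
  then have "x = cadjoint T (T x)" by (simp add: op_kernel_def)
  then have "inner (T x) (T x) = inner x x"
    using inner_cadjoint[OF T, of x "T x"] by simp
  then show "norm (T x) = norm x" by (simp add: norm_eq_sqrt_inner)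
next
  assume "norm (T x) = norm x"
  then show "x \<in> op_kernel (\<lambda>x. x - cadjoint T (T x))"
    using norm_defect_le[OF T, of x] by (simp add: op_kernel_def)
qed

section \<open>The Harnack kernel as a quadratic form\<close>

text \<open>The map sending \<open>y\<close> to \<open>x + w *\<^sub>C T y\<close> is Lipschitz with
  constant \<open>norm w < 1\<close>, so Banach's fixed point theorem applies.\<close>

lemma contraction_resolvent:
  assumes T: "T \<in> contractions" and w: "norm w < 1"
  shows "\<exists>!y. y - w *\<^sub>C T y = (x :: 'a::complex_hilbert)"
proof -
  interpret T: bounded_linear T using T contractionsD bounded_clinearD by blast
  have "\<exists>!y. x + w *\<^sub>C T y = y"
  proof (rule banach_fix_type[of "norm w"])
    show "\<forall>a b. dist (x + w *\<^sub>C T a) (x + w *\<^sub>C T b) \<le> norm w * dist a b"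
      using contractionsD(2)[OF T]
      by (simp add: dist_norm norm_scaleC mult_left_mono flip: scaleC.diff_right T.diff)
  qed (use w in auto)
  moreover have "x + w *\<^sub>C T y = y \<longleftrightarrow> y - w *\<^sub>C T y = x" for y
    by (auto simp: algebra_simps)
  ultimately show ?thesis by simp
qed

lemma inv_eq_ex1:
  assumes "\<exists>!y. f y = x" "f y = x"
  shows "inv f x = y"
  using assms by (metis (mono_tags, lifting) f_inv_into_f rangeI)

text \<open>If \<open>y\<close> and \<open>y'\<close> are the images of \<open>x\<close> under the
  two resolvents, then \<open>cinner y' x = cinner x y\<close>. Completing the square turns the form
  into \<open>(norm y)\<^sup>2 - (norm (y - x))\<^sup>2\<close>, where
  \<open>y - x = cnj z *\<^sub>C T y\<close>.\<close>

lemma harnack_kernel_form: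
  fixes T :: "'a::complex_hilbert \<Rightarrow> 'a"
  assumes T: "T \<in> contractions" and z: "norm z < 1" and y: "y - cnj z *\<^sub>C T y = x"
  shows "cinner (harnack_kernel z T x) x = of_real ((norm y)\<^sup>2 - (norm z)\<^sup>2 * (norm (T y))\<^sup>2)"
proof -
  obtain y' where y': "y' - z *\<^sub>C cadjoint T y' = x"
    using contraction_resolvent[OF cadjoint_contraction[OF T] z] by metis
  have "harnack_kernel z T x = y + y' - x"
    unfolding harnack_kernel_def
    using inv_eq_ex1[OF contraction_resolvent[OF T] y] z
      inv_eq_ex1[OF contraction_resolvent[OF cadjoint_contraction[OF T] z] y'] by simp
  moreover have "cinner y' x = cinner x y"
  proof -
    have "cinner y' (T y) = cinner (cadjoint T y') y"
      using cinner_cadjoint[OF contractionsD(1)[OF T], of y y'] cinner_commute by metis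
    then show ?thesis
      unfolding y[symmetric] cinner_right.diff cinner_scaleC_right
      unfolding y y'[symmetric] cinner_left.diff cinner_scaleC_left by simp
  qed
  ultimately have "cinner (harnack_kernel z T x) x = cinner y x + cinner x y - cinner x x"
    by (simp add: cinner_left.diff cinner_add_left)
  also have "\<dots> = cinner y y - cinner (y - x) (y - x)"
    by (simp add: cinner_left.diff cinner_right.diff)
  also have "y - x = cnj z *\<^sub>C T y" using y by (simp add: algebra_simps)
  finally show ?thesis
    by (simp add: cinner_self norm_scaleC power_mult_distrib)
qed

text \<open>Inverses disappear once the test vector is parametrized by its two resolvent images
  \<open>x\<close> and \<open>y\<close>. Here \<open>w\<close> stands for \<open>cnj z\<close>,
  which runs over the same disc.\<close>

lemma harnack_dominated_iff:
  fixes S T :: "'a::complex_hilbert \<Rightarrow> 'a"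
  assumes S: "S \<in> contractions" and T: "T \<in> contractions"
  shows "harnack_dominated S T \<longleftrightarrow> (\<exists>c\<ge>1. \<forall>w x y. norm w < 1 \<longrightarrow> x - w *\<^sub>C S x = y - w *\<^sub>C T y \<longrightarrow>
    (norm x)\<^sup>2 - (norm w)\<^sup>2 * (norm (S x))\<^sup>2 \<le> c\<^sup>2 * ((norm y)\<^sup>2 - (norm w)\<^sup>2 * (norm (T y))\<^sup>2))"
proof -
  have form: "cinner (c\<^sup>2 *\<^sub>R harnack_kernel z T u - harnack_kernel z S u) u
    = of_real (c\<^sup>2 * ((norm y)\<^sup>2 - (norm z)\<^sup>2 * (norm (T y))\<^sup>2) - ((norm x)\<^sup>2 - (norm z)\<^sup>2 * (norm (S x))\<^sup>2))"
    if "norm z < 1" "x - cnj z *\<^sub>C S x = u" "y - cnj z *\<^sub>C T y = u" for c z u x y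
    using harnack_kernel_form[OF S that(1,2)] harnack_kernel_form[OF T that(1,3)]
    by (simp add: cinner_left.diff cinner_scaleC_left flip: scaleC_of_real)
  have "(\<forall>z\<in>ball 0 1. op_le (harnack_kernel z S) (\<lambda>x. c\<^sup>2 *\<^sub>R harnack_kernel z T x)) \<longleftrightarrow>
    (\<forall>w x y. norm w < 1 \<longrightarrow> x - w *\<^sub>C S x = y - w *\<^sub>C T y \<longrightarrow>
    (norm x)\<^sup>2 - (norm w)\<^sup>2 * (norm (S x))\<^sup>2 \<le> c\<^sup>2 * ((norm y)\<^sup>2 - (norm w)\<^sup>2 * (norm (T y))\<^sup>2))"
    (is "?L \<longleftrightarrow> ?R") for c
  proof
    assume L: ?L
    show ?R
    proof (intro allI impI)
      fix w x y assume w: "norm w < 1" and eq: "x - w *\<^sub>C S x = y - w *\<^sub>C T y"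
      have "cinner (c\<^sup>2 *\<^sub>R harnack_kernel (cnj w) T (x - w *\<^sub>C S x)
          - harnack_kernel (cnj w) S (x - w *\<^sub>C S x)) (x - w *\<^sub>C S x) \<in> \<real>\<^sub>\<ge>\<^sub>0"
        using L w by (simp add: op_le_def)
      then show "(norm x)\<^sup>2 - (norm w)\<^sup>2 * (norm (S x))\<^sup>2 \<le> c\<^sup>2 * ((norm y)\<^sup>2 - (norm w)\<^sup>2 * (norm (T y))\<^sup>2)"
        by (subst (asm) form[of _ x _ y]) (use w eq in \<open>simp_all only: nonneg_Reals_of_real_iff, auto\<close>)
    qed
  next
    assume R: ?R
    show ?L
      unfolding op_le_def
    proof (intro ballI allI)
      fix z u assume "z \<in> ball (0::complex) 1"
      then have z: "norm z < 1" "norm (cnj z) < 1" by auto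
      obtain x y where xy: "x - cnj z *\<^sub>C S x = u" "y - cnj z *\<^sub>C T y = u"
        using contraction_resolvent[OF S z(2)] contraction_resolvent[OF T z(2)] by metis
      show "cinner (c\<^sup>2 *\<^sub>R harnack_kernel z T u - harnack_kernel z S u) u \<in> \<real>\<^sub>\<ge>\<^sub>0"
        unfolding form[OF z(1) xy] nonneg_Reals_of_real_iff
        using R[rule_format, OF z(2), of x y] xy by simp
    qed
  qed
  then show ?thesis by (simp add: harnack_dominated_def)
qed

section \<open>Compact contractions\<close>

text \<open>Failure of the bound gives unit vectors \<open>x n\<close> with
  \<open>x n - w n *\<^sub>C T (x n)\<close> tending to 0. Compactness yields a unit vector
  \<open>a\<close> and a limit \<open>l\<close> of the parameters with \<open>a\<close> equal to
  \<open>l\<close> times \<open>T a\<close>. Since \<open>T\<close> is a contraction,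
  \<open>l\<close> is unimodular, and its conjugate is a forbidden eigenvalue.\<close>

lemma compact_contraction_resolvent_bound:
  fixes T :: "'a::complex_hilbert \<Rightarrow> 'a"
  assumes T: "T \<in> contractions" and cpt: "compact_operator T" and G: "Gamma_p T = {}"
  obtains C where "\<And>w y. norm w \<le> 1 \<Longrightarrow> norm y \<le> C * norm (y - w *\<^sub>C T y)"
proof -
  interpret T: bounded_linear T using T contractionsD bounded_clinearD by blast
  have "\<exists>C. \<forall>w y. norm w \<le> 1 \<longrightarrow> norm y \<le> C * norm (y - w *\<^sub>C T y)"
  proof (rule ccontr)
    assume neg: "\<not> ?thesis"
    have "\<exists>w y. norm w \<le> 1 \<and> real (Suc n) * norm (y - w *\<^sub>C T y) < norm y" for n
      using neg by (meson not_less)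
    then obtain w y where w: "\<And>n. norm (w n) \<le> 1"
      and y: "\<And>n. real (Suc n) * norm (y n - w n *\<^sub>C T (y n)) < norm (y n)"
      by metis
    have y0: "norm (y n) > 0" for n
      by (rule le_less_trans[OF _ y[of n]]) simp
    define x where "x n = inverse (norm (y n)) *\<^sub>R y n" for n
    have x1: "norm (x n) = 1" for n using y0[of n] by (simp add: x_def)
    have small: "norm (x n - w n *\<^sub>C T (x n)) \<le> inverse (real (Suc n))" for n
    proof -
      have "x n - w n *\<^sub>C T (x n) = inverse (norm (y n)) *\<^sub>R (y n - w n *\<^sub>C T (y n))"
        by (simp add: x_def T.scaleR scaleC.scaleR_right scaleR_diff_right)
      then have "norm (x n - w n *\<^sub>C T (x n)) = inverse (norm (y n)) * norm (y n - w n *\<^sub>C T (y n))"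
        by simp
      also have "\<dots> \<le> inverse (real (Suc n))"
        using y[of n] y0[of n] by (simp add: field_simps)
      finally show ?thesis .
    qed
    have "compact (cball (0::complex) 1 \<times> closure (T ` cball 0 1))"
      using cpt by (intro compact_Times) (auto simp: compact_operator_def)
    moreover have "\<forall>n. (w n, T (x n)) \<in> cball 0 1 \<times> closure (T ` cball 0 1)"
      using w x1 closure_subset[of "T ` cball 0 1"] by auto
    ultimately have "\<exists>l \<in> cball 0 1 \<times> closure (T ` cball 0 1). \<exists>r. strict_mono r \<and>
        ((\<lambda>n. (w n, T (x n))) \<circ> r) \<longlonglongrightarrow> l"
      by (rule compact_def[THEN iffD1, THEN spec, THEN mp])
    then obtain l r where l: "l \<in> cball 0 1 \<times> closure (T ` cball 0 1)"
      and r: "strict_mono r" and lim: "((\<lambda>n. (w n, T (x n))) \<circ> r) \<longlonglongrightarrow> l"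
      by blast
    define a where "a = fst l *\<^sub>C snd l"
    have wr: "(\<lambda>n. w (r n)) \<longlonglongrightarrow> fst l" and Tr: "(\<lambda>n. T (x (r n))) \<longlonglongrightarrow> snd l"
      using tendsto_fst[OF lim] tendsto_snd[OF lim] by (simp_all add: o_def)
    have "(\<lambda>n. x n - w n *\<^sub>C T (x n)) \<longlonglongrightarrow> 0"
      by (rule Lim_null_comparison[OF _ LIMSEQ_inverse_real_of_nat]) (use small in auto)
    \<comment> \<open>Compactness controls only the images \<open>T (x n)\<close>; the vectors
      themselves converge because they differ from \<open>w n *\<^sub>C T (x n)\<close> by a null
      sequence.\<close>
    then have "(\<lambda>n. (x (r n) - w (r n) *\<^sub>C T (x (r n))) + w (r n) *\<^sub>C T (x (r n))) \<longlonglongrightarrow> 0 + a"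
      unfolding a_def
      by (intro tendsto_add scaleC.tendsto wr Tr)
        (use LIMSEQ_subseq_LIMSEQ[OF _ r] in \<open>fastforce simp: o_def\<close>)
    then have xr: "(\<lambda>n. x (r n)) \<longlonglongrightarrow> a" by simp
    have "snd l = T a"
      using LIMSEQ_unique[OF Tr T.tendsto[OF xr]] .
    then have fix_a: "a = fst l *\<^sub>C T a" by (simp add: a_def)
    have a1: "norm a = 1"
      using LIMSEQ_unique[OF tendsto_norm[OF xr]] x1 by simp
    have "1 = norm (fst l) * norm (T a)"
      using arg_cong[OF fix_a, of norm] a1 by (simp add: norm_scaleC)
    also have "\<dots> \<le> norm (fst l) * 1"
      using contractionsD(2)[OF T, of a] a1 by (intro mult_left_mono) auto
    finally have "norm (fst l) = 1" using l by (auto simp: mem_Times_iff)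
    then have "cnj (fst l) *\<^sub>C a = T a" and "norm (cnj (fst l)) = 1"
      using arg_cong[OF fix_a, of "scaleC (cnj (fst l))"]
      by (simp_all add: scaleC_scaleC scaleC_one mult.commute[of "cnj _"] flip: complex_norm_square)
    then have "cnj (fst l) \<in> Gamma_p T"
      using a1 by (auto simp: Gamma_p_def point_spectrum_def intro!: exI[of _ a])
    with G show False by simp
  qed
  then show thesis using that by blast
qed

text \<open>Otherwise unit vectors orthogonal to all norm-preserved vectors have defects tending to
  0. By \<open>norm_defect_le\<close> and compactness a subsequence converges to a unit vector whose
  norm \<open>T\<close> preserves, and this limit is orthogonal to itself.\<close>

lemma defect_coercive_on_complement:
  fixes T :: "'a::complex_hilbert \<Rightarrow> 'a"
  assumes T: "T \<in> contractions" and cpt: "compact_operator T"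
  obtains \<delta> where "\<delta> > 0" "\<And>f. (\<And>e. norm (T e) = norm e \<Longrightarrow> inner e f = 0) \<Longrightarrow>
    \<delta> * (norm f)\<^sup>2 \<le> (norm f)\<^sup>2 - (norm (T f))\<^sup>2"
proof -
  interpret T: bounded_linear T using T contractionsD bounded_clinearD by blast
  interpret T': bounded_linear "cadjoint T"
    using cadjoint_contraction[OF T] contractionsD bounded_clinearD by blast
  have "\<exists>\<delta>>0. \<forall>f. (\<forall>e. norm (T e) = norm e \<longrightarrow> inner e f = 0) \<longrightarrow>
    \<delta> * (norm f)\<^sup>2 \<le> (norm f)\<^sup>2 - (norm (T f))\<^sup>2"
  proof (rule ccontr)
    assume neg: "\<not> ?thesis"
    have "\<exists>f. (\<forall>e. norm (T e) = norm e \<longrightarrow> inner e f = 0) \<and>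
      (norm f)\<^sup>2 - (norm (T f))\<^sup>2 < inverse (real (Suc n)) * (norm f)\<^sup>2" for n
      using neg by (metis inverse_positive_iff_positive not_less of_nat_0_less_iff zero_less_Suc)
    then obtain g where orth: "\<And>n e. norm (T e) = norm e \<Longrightarrow> inner e (g n) = 0"
      and g: "\<And>n. (norm (g n))\<^sup>2 - (norm (T (g n)))\<^sup>2 < inverse (real (Suc n)) * (norm (g n))\<^sup>2"
      by metis
    have g0: "norm (g n) \<noteq> 0" for n
      using g[of n] by (auto simp: T.zero)
    define f where "f n = inverse (norm (g n)) *\<^sub>R g n" for n
    have f1: "norm (f n) = 1" for n using g0[of n] by (simp add: f_def)
    have orth': "inner e (f n) = 0" if "norm (T e) = norm e" for e n
      using orth[OF that] by (simp add: f_def)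
    have small: "1 - (norm (T (f n)))\<^sup>2 \<le> inverse (real (Suc n))" for n
    proof -
      have "1 - (norm (T (f n)))\<^sup>2 = ((norm (g n))\<^sup>2 - (norm (T (g n)))\<^sup>2) / (norm (g n))\<^sup>2"
        using g0[of n] by (simp add: f_def T.scaleR power_mult_distrib field_simps)
      also have "\<dots> \<le> inverse (real (Suc n)) * (norm (g n))\<^sup>2 / (norm (g n))\<^sup>2"
        using g[of n] by (intro divide_right_mono) auto
      also have "\<dots> = inverse (real (Suc n))" using g0[of n] by simp
      finally show ?thesis .
    qed
    have "compact (closure (T ` cball 0 1))" using cpt by (auto simp: compact_operator_def)
    moreover have "\<forall>n. T (f n) \<in> closure (T ` cball 0 1)"
      using f1 closure_subset[of "T ` cball 0 1"] by auto
    ultimately have "\<exists>v \<in> closure (T ` cball 0 1). \<exists>r. strict_mono r \<and> ((\<lambda>n. T (f n)) \<circ> r) \<longlonglongrightarrow> v"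
      by (rule compact_def[THEN iffD1, THEN spec, THEN mp])
    then obtain v r where r: "strict_mono r" and "((\<lambda>n. T (f n)) \<circ> r) \<longlonglongrightarrow> v"
      by blast
    then have Tr: "(\<lambda>n. T (f (r n))) \<longlonglongrightarrow> v" by (simp add: o_def)
    have inv_r: "(\<lambda>n. inverse (real (Suc (r n)))) \<longlonglongrightarrow> 0"
      using LIMSEQ_subseq_LIMSEQ[OF LIMSEQ_inverse_real_of_nat r] by (simp add: o_def)
    have "(\<lambda>n. (norm (f (r n) - cadjoint T (T (f (r n)))))\<^sup>2) \<longlonglongrightarrow> 0"
    proof (rule Lim_null_comparison[OF _ inv_r], rule always_eventually, rule allI)
      fix n
      show "norm ((norm (f (r n) - cadjoint T (T (f (r n)))))\<^sup>2) \<le> inverse (real (Suc (r n)))"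
        using norm_defect_le[OF T, of "f (r n)"] small[of "r n"] f1[of "r n"] by simp
    qed
    then have "(\<lambda>n. f (r n) - cadjoint T (T (f (r n)))) \<longlonglongrightarrow> 0"
      by (simp add: tendsto_norm_zero_iff)
    from tendsto_add[OF this T'.tendsto[OF Tr]]
    have fr: "(\<lambda>n. f (r n)) \<longlonglongrightarrow> cadjoint T v" (is "_ \<longlonglongrightarrow> ?h") by simp
    have h1: "norm ?h = 1"
      using LIMSEQ_unique[OF tendsto_norm[OF fr]] f1 by simp
    have "(\<lambda>n. 1 - (norm (T (f (r n))))\<^sup>2) \<longlonglongrightarrow> 1 - (norm (T ?h))\<^sup>2"
      by (intro tendsto_intros T.tendsto fr)
    then have "1 - (norm (T ?h))\<^sup>2 \<le> 0"
      by (rule LIMSEQ_le[OF _ inv_r]) (use small in blast)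
    moreover have "norm (T ?h) \<le> 1" using contractionsD(2)[OF T, of ?h] h1 by simp
    ultimately have "norm (T ?h) = norm ?h"
      using h1 abs_square_less_1[of "norm (T ?h)"] by (simp add: less_le)
    from orth'[OF this] have "inner ?h ?h = 0"
      using tendsto_inner[OF tendsto_const fr, of ?h] by (simp add: LIMSEQ_const_iff)
    with h1 show False by auto
  qed
  then show thesis using that by blast
qed

section \<open>Orbits and averages over roots of unity\<close>

text \<open>The sum telescopes: a truncated Neumann series solves the resolvent equation up to its
  first omitted term.\<close>

lemma Neumann_partial_sum:
  fixes S :: "'a::complex_hilbert \<Rightarrow> 'a"
  assumes "bounded_clinear S"
  shows "(\<Sum>k<n. w ^ k *\<^sub>C (S ^^ k) y) - w *\<^sub>C S (\<Sum>k<n. w ^ k *\<^sub>C (S ^^ k) y)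
    = y - w ^ n *\<^sub>C (S ^^ n) y"
proof -
  interpret S: bounded_linear S using assms by (rule bounded_clinearD)
  show ?thesis
  proof (induction n)
    case (Suc n)
    define P where "P = (\<Sum>k<n. w ^ k *\<^sub>C (S ^^ k) y)"
    have IH: "P - w *\<^sub>C S P = y - w ^ n *\<^sub>C (S ^^ n) y"
      unfolding P_def by (rule Suc.IH)
    have split: "(P + w ^ n *\<^sub>C (S ^^ n) y) - w *\<^sub>C S (P + w ^ n *\<^sub>C (S ^^ n) y)
      = (P - w *\<^sub>C S P) + w ^ n *\<^sub>C (S ^^ n) y - w ^ Suc n *\<^sub>C (S ^^ Suc n) y"
      by (simp add: S.add scaleC.add_right bounded_clinearD(2)[OF assms] scaleC_scaleC)
    show ?case unfolding sum.lessThan_Suc P_def[symmetric] split IH by simp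
  qed (simp add: S.zero scaleC.zero_right scaleC_one)
qed

lemma contraction_funpow_norm_le:
  assumes "S \<in> contractions"
  shows "norm ((S ^^ n) y) \<le> norm y"
proof (induction n)
  case (Suc n)
  then show ?case using contractionsD(2)[OF assms, of "(S ^^ n) y"] by simp
qed simp

text \<open>On the unit circle the resolvent bound controls all Neumann partial sums uniformly.
  Parseval then bounds the partial sums of the squared orbit norms, which are therefore
  summable.\<close>

lemma orbit_tendsto_0:
  fixes S :: "'a::complex_hilbert \<Rightarrow> 'a"
  assumes S: "S \<in> contractions"
    and C: "\<And>w y. norm w \<le> 1 \<Longrightarrow> norm y \<le> C * norm (y - w *\<^sub>C S y)"
  shows "(\<lambda>n. (S ^^ n) y) \<longlonglongrightarrow> 0"
proof -
  have bound: "norm (\<Sum>k<n. w ^ k *\<^sub>C (S ^^ k) y) \<le> \<bar>C\<bar> * (2 * norm y)" if "norm w = 1" for w n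
  proof -
    have "norm (y - w ^ n *\<^sub>C (S ^^ n) y) \<le> norm y + norm (w ^ n *\<^sub>C (S ^^ n) y)"
      by (rule norm_triangle_ineq4)
    also have "\<dots> \<le> 2 * norm y"
      using contraction_funpow_norm_le[OF S, of n y] that by (simp add: norm_scaleC norm_power)
    finally have "\<bar>C\<bar> * norm (y - w ^ n *\<^sub>C (S ^^ n) y) \<le> \<bar>C\<bar> * (2 * norm y)"
      by (intro mult_left_mono) auto
    moreover have "C * norm (y - w ^ n *\<^sub>C (S ^^ n) y) \<le> \<bar>C\<bar> * norm (y - w ^ n *\<^sub>C (S ^^ n) y)"
      by (intro mult_right_mono) auto
    ultimately show ?thesis
      using C[of w "\<Sum>k<n. w ^ k *\<^sub>C (S ^^ k) y"] that
      unfolding Neumann_partial_sum[OF contractionsD(1)[OF S]] by simp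
  qed
  have "(\<Sum>k<n. (norm ((S ^^ k) y))\<^sup>2) \<le> (\<bar>C\<bar> * (2 * norm y))\<^sup>2" for n
  proof (cases "n = 0")
    case False
    have "n * (\<Sum>k<n. (norm ((S ^^ k) y))\<^sup>2)
      = (\<Sum>k<n. (norm (\<Sum>j<n. (cis (2 * pi * real k / real n)) ^ j *\<^sub>C (S ^^ j) y))\<^sup>2)"
      using False by (simp add: sum_roots_of_unity_Parseval)
    also have "\<dots> \<le> (\<Sum>k<n. (\<bar>C\<bar> * (2 * norm y))\<^sup>2)"
      by (intro sum_mono power_mono bound) auto
    finally show ?thesis using False by simp
  qed simp
  then have "summable (\<lambda>k. (norm ((S ^^ k) y))\<^sup>2)"
    by (intro summableI_nonneg_bounded) auto
  then show ?thesis
    using summable_LIMSEQ_zero tendsto_norm_zero_iff by fastforce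
qed

section \<open>Harnack domination\<close>

text \<open>At an eigenvector of \<open>S\<close> with eigenvalue \<mu>, tested at \<open>w\<close>
  equal to \<open>r\<close> times the conjugate of \<mu>, the form of \<open>S\<close> is of first
  order in \<open>1 - r\<close>. The resolvent bound for \<open>T\<close> makes the dominating form
  of second order, which is impossible near \<open>r = 1\<close>.\<close>

lemma harnack_dominated_imp_no_unimodular_eigenvalue:
  fixes S T :: "'a::complex_hilbert \<Rightarrow> 'a"
  assumes S: "S \<in> contractions" and T: "T \<in> contractions" and dom: "harnack_dominated S T"
    and C: "\<And>w y. norm w \<le> 1 \<Longrightarrow> norm y \<le> C * norm (y - w *\<^sub>C T y)"
  shows "Gamma_p S = {}"
proof (rule ccontr)
  assume "Gamma_p S \<noteq> {}"
  then obtain \<mu> x where \<mu>: "norm \<mu> = 1" and x: "x \<noteq> 0" "S x = \<mu> *\<^sub>C x"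
    by (auto simp: Gamma_p_def point_spectrum_def)
  obtain c where c: "\<And>w x y. norm w < 1 \<Longrightarrow> x - w *\<^sub>C S x = y - w *\<^sub>C T y \<Longrightarrow>
    (norm x)\<^sup>2 - (norm w)\<^sup>2 * (norm (S x))\<^sup>2 \<le> c\<^sup>2 * ((norm y)\<^sup>2 - (norm w)\<^sup>2 * (norm (T y))\<^sup>2)"
    using dom unfolding harnack_dominated_iff[OF S T] by blast
  define K where "K = c\<^sup>2 * C\<^sup>2"
  have K0: "K \<ge> 0" by (simp add: K_def)
  \<comment> \<open>This gives \<open>K * (1 - r) = K / (K + 1) < 1\<close>, whereas domination will
    require \<open>1 + r \<le> K * (1 - r)\<close>.\<close>
  define r where "r = 1 - 1 / (K + 1)"
  have r: "0 \<le> r" "r < 1" using K0 by (auto simp: r_def)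
  define w where "w = of_real r * cnj \<mu>"
  have nw: "norm w = r" using r \<mu> by (simp add: w_def norm_mult)
  have "w * \<mu> = of_real r"
    using \<mu> by (simp add: w_def mult.commute[of "cnj \<mu>"] mult.assoc flip: complex_norm_square)
  then have Sx: "x - w *\<^sub>C S x = (1 - r) *\<^sub>R x"
    by (simp add: x(2) scaleC_scaleC scaleC_of_real algebra_simps)
  obtain y where y: "y - w *\<^sub>C T y = (1 - r) *\<^sub>R x"
    using contraction_resolvent[OF T, of w] nw r by metis
  have "(1 - r\<^sup>2) * (norm x)\<^sup>2 = (norm x)\<^sup>2 - (norm w)\<^sup>2 * (norm (S x))\<^sup>2"
    using nw \<mu> by (simp add: x(2) norm_scaleC algebra_simps)
  also have "\<dots> \<le> c\<^sup>2 * ((norm y)\<^sup>2 - (norm w)\<^sup>2 * (norm (T y))\<^sup>2)"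
    using c[of w x y] nw r Sx y by simp
  also have "\<dots> \<le> c\<^sup>2 * (norm y)\<^sup>2"
    by (intro mult_left_mono) auto
  also have "\<dots> \<le> c\<^sup>2 * (C * norm ((1 - r) *\<^sub>R x))\<^sup>2"
    using C[of w y] nw r unfolding y by (intro mult_left_mono power_mono) auto
  also have "\<dots> = K * (1 - r)\<^sup>2 * (norm x)\<^sup>2"
    by (simp add: K_def power_mult_distrib)
  finally have "((1 + r) * (1 - r)) * (norm x)\<^sup>2 \<le> ((K * (1 - r)) * (1 - r)) * (norm x)\<^sup>2"
    by (simp add: power2_eq_square algebra_simps)
  then have "(1 + r) * (1 - r) \<le> (K * (1 - r)) * (1 - r)"
    by (rule mult_right_le_imp_le) (use x(1) in simp)
  then have "1 + r \<le> K * (1 - r)" using r by simp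
  also have "K * (1 - r) < 1" using K0 by (simp add: r_def field_simps)
  finally show False using r by simp
qed

text \<open>
  Since \<open>e - w *\<^sub>C T e\<close> has defect form \<open>(1 - |w|\<^sup>2) * (norm e)\<^sup>2\<close> for \<open>T\<close>, domination forces the
  defect form of \<open>S\<close> to vanish, as \<open>|w| \<rightarrow> 1\<close>, along the curve solving
  \<open>x - w *\<^sub>C S x = e - w *\<^sub>C T e\<close>. The power series coefficients of this curve are \<open>e\<close> and
  \<open>(S ^^ k) (S e - T e)\<close>, and averaging over \<open>w\<close> decouples them.
\<close>

lemma harnack_dominated_imp_isometric:
  fixes S T :: "'a::complex_hilbert \<Rightarrow> 'a"
  assumes S: "S \<in> contractions" and T: "T \<in> contractions" and dom: "harnack_dominated S T"
    and C: "\<And>w y. norm w \<le> 1 \<Longrightarrow> norm y \<le> C * norm (y - w *\<^sub>C S y)"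
    and e: "norm (T e) = norm e"
  shows "norm (S e) = norm e" "S e = T e"
proof -
  interpret S: bounded_linear S using S contractionsD bounded_clinearD by blast
  note S_scaleC = bounded_clinearD(2)[OF contractionsD(1)[OF S]]
  obtain c where c: "\<And>w x y. norm w < 1 \<Longrightarrow> x - w *\<^sub>C S x = y - w *\<^sub>C T y \<Longrightarrow>
    (norm x)\<^sup>2 - (norm w)\<^sup>2 * (norm (S x))\<^sup>2 \<le> c\<^sup>2 * ((norm y)\<^sup>2 - (norm w)\<^sup>2 * (norm (T y))\<^sup>2)"
    using dom unfolding harnack_dominated_iff[OF S T] by blast
  define u where "u = S e - T e"
  \<comment> \<open>The shift by one comes from
    \<open>e - w *\<^sub>C T e = (e - w *\<^sub>C S e) + w *\<^sub>C u\<close>: the resolvent of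
    \<open>S\<close> returns \<open>e\<close> from the first part and \<open>w\<close> times the
    Neumann series of \<open>u\<close> from the second.\<close>
  define v where "v j = (case j of 0 \<Rightarrow> e | Suc k \<Rightarrow> (S ^^ k) u)" for j
  define p where "p w n = (\<Sum>j<Suc n. w ^ j *\<^sub>C v j)" for w n
  define q where "q w x = (norm x)\<^sup>2 - (norm w)\<^sup>2 * (norm (S x))\<^sup>2" for w :: complex and x
  have res: "p w n - w *\<^sub>C S (p w n) = e - w *\<^sub>C T e - w ^ Suc n *\<^sub>C (S ^^ n) u" for w n
  proof -
    define Q where "Q = (\<Sum>k<n. w ^ k *\<^sub>C (S ^^ k) u)"
    have p: "p w n = e + w *\<^sub>C Q"
      unfolding p_def Q_def sum.lessThan_Suc_shift
      by (simp add: v_def scaleC_one scaleC.sum_right scaleC_scaleC)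
    have "p w n - w *\<^sub>C S (p w n) = e - w *\<^sub>C S e + w *\<^sub>C (Q - w *\<^sub>C S Q)"
      by (simp add: p S.add S_scaleC scaleC.add_right scaleC.diff_right)
    also have "Q - w *\<^sub>C S Q = u - w ^ n *\<^sub>C (S ^^ n) u"
      unfolding Q_def by (rule Neumann_partial_sum[OF contractionsD(1)[OF S]])
    finally show ?thesis
      by (simp add: u_def scaleC.diff_right scaleC.add_right scaleC_scaleC algebra_simps)
  qed
  \<comment> \<open>Together with \<open>q_nonneg\<close> this gives
    \<open>q w (a + b) \<le> 2 * q w a + 2 * q w b\<close>, a substitute for the triangle
    inequality.\<close>
  have q_par: "q w (a + b) + q w (a - b) = 2 * q w a + 2 * q w b" for w a b
  proof -
    have "(norm w)\<^sup>2 * ((norm (S (a + b)))\<^sup>2 + (norm (S (a - b)))\<^sup>2)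
      = (norm w)\<^sup>2 * (2 * (norm (S a))\<^sup>2 + 2 * (norm (S b))\<^sup>2)"
      unfolding S.add S.diff parallelogram ..
    then show ?thesis
      using parallelogram[of a b] by (simp add: q_def distrib_left)
  qed
  have q_nonneg: "q w a \<ge> 0" if "norm w < 1" for w a
  proof -
    have "(norm w)\<^sup>2 * (norm (S a))\<^sup>2 \<le> 1 * (norm a)\<^sup>2"
      using that by (intro mult_mono power_mono contractionsD(2)[OF S] power_le_one) auto
    then show ?thesis by (simp add: q_def)
  qed
  \<comment> \<open>The polynomial \<open>p w n\<close> is compared with the exact solution
    \<open>x\<close>. Domination bounds the form at \<open>x\<close>, and the resolvent bound for
    \<open>S\<close> controls the truncation error \<open>d\<close>.\<close>
  have key: "q w (p w n) \<le> 2 * (c\<^sup>2 * ((1 - (norm w)\<^sup>2) * (norm e)\<^sup>2)) + 2 * (\<bar>C\<bar> * norm ((S ^^ n) u))\<^sup>2"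
    if w: "norm w < 1" for w n
  proof -
    obtain x where x: "x - w *\<^sub>C S x = e - w *\<^sub>C T e"
      using contraction_resolvent[OF S w] by metis
    have qx: "q w x \<le> c\<^sup>2 * ((1 - (norm w)\<^sup>2) * (norm e)\<^sup>2)"
      using c[OF w x] by (simp add: q_def e algebra_simps)
    define d where "d = p w n - x"
    have "d - w *\<^sub>C S d = (p w n - w *\<^sub>C S (p w n)) - (x - w *\<^sub>C S x)"
      by (simp add: d_def S.diff scaleC.diff_right)
    also have "\<dots> = - (w ^ Suc n *\<^sub>C (S ^^ n) u)" by (simp only: res x) simp
    finally have "norm d \<le> C * norm (w ^ Suc n *\<^sub>C (S ^^ n) u)"
      using C[of w d] w by simp
    also have "\<dots> \<le> \<bar>C\<bar> * norm (w ^ Suc n *\<^sub>C (S ^^ n) u)"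
      by (intro mult_right_mono) auto
    also have "\<dots> \<le> \<bar>C\<bar> * (1 * norm ((S ^^ n) u))"
      unfolding norm_scaleC norm_power
      using w by (intro mult_left_mono mult_right_mono power_le_one) auto
    finally have "(norm d)\<^sup>2 \<le> (\<bar>C\<bar> * norm ((S ^^ n) u))\<^sup>2"
      by (intro power_mono) auto
    moreover have "q w d \<le> (norm d)\<^sup>2" by (simp add: q_def)
    moreover have "q w (p w n) \<le> 2 * q w x + 2 * q w d"
      using q_par[of w x d] q_nonneg[OF w, of "x - d"] by (simp add: d_def)
    ultimately show ?thesis using qx by linarith
  qed
  \<comment> \<open>The estimate \<open>key\<close> is averaged over the roots of unity of order
    \<open>Suc n\<close>, scaled by \<open>r\<close>. As \<open>p\<close> has \<open>Suc n\<close>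
    coefficients, Parseval applies exactly, both to \<open>p\<close> and to its image under
    \<open>S\<close>.\<close>
  have avg: "(\<Sum>j<Suc n. r ^ (2 * j) * ((norm (v j))\<^sup>2 - r\<^sup>2 * (norm (S (v j)))\<^sup>2))
      \<le> 2 * (c\<^sup>2 * ((1 - r\<^sup>2) * (norm e)\<^sup>2)) + 2 * (\<bar>C\<bar> * norm ((S ^^ n) u))\<^sup>2"
    if r: "0 < r" "r < 1" for r n
  proof -
    define \<zeta> where "\<zeta> k = cis (2 * pi * real k / real (Suc n))" for k
    have n\<zeta>: "norm (of_real r * \<zeta> k) = r" for k
      using r by (simp add: \<zeta>_def norm_mult)
    have p_r: "p (of_real r * \<zeta> k) n = (\<Sum>j<Suc n. \<zeta> k ^ j *\<^sub>C (r ^ j *\<^sub>R v j))" for k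
      unfolding p_def by (intro sum.cong refl)
        (simp add: power_mult_distrib mult.commute scaleC_scaleC flip: scaleC_of_real)
    have Sp_r: "S (p (of_real r * \<zeta> k) n) = (\<Sum>j<Suc n. \<zeta> k ^ j *\<^sub>C (r ^ j *\<^sub>R S (v j)))" for k
      unfolding p_r S.sum S_scaleC S.scaleR ..
    have "real (Suc n) * (\<Sum>j<Suc n. r ^ (2 * j) * ((norm (v j))\<^sup>2 - r\<^sup>2 * (norm (S (v j)))\<^sup>2))
      = real (Suc n) * (\<Sum>j<Suc n. (norm (r ^ j *\<^sub>R v j))\<^sup>2)
        - r\<^sup>2 * (real (Suc n) * (\<Sum>j<Suc n. (norm (r ^ j *\<^sub>R S (v j)))\<^sup>2))"
    proof -
      have "(\<Sum>j<Suc n. r ^ (2 * j) * ((norm (v j))\<^sup>2 - r\<^sup>2 * (norm (S (v j)))\<^sup>2))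
        = (\<Sum>j<Suc n. (norm (r ^ j *\<^sub>R v j))\<^sup>2 - r\<^sup>2 * (norm (r ^ j *\<^sub>R S (v j)))\<^sup>2)"
        using r by (intro sum.cong refl)
          (simp add: power_mult_distrib algebra_simps power_even_eq flip: power_mult)
      then show ?thesis
        by (simp only: sum_subtractf sum_distrib_left[symmetric]) (simp only: algebra_simps)
    qed
    also have "\<dots> = (\<Sum>k<Suc n. q (of_real r * \<zeta> k) (p (of_real r * \<zeta> k) n))"
      unfolding sum_roots_of_unity_Parseval[OF zero_less_Suc, symmetric] q_def n\<zeta> Sp_r
      unfolding p_r unfolding \<zeta>_def sum_subtractf sum_distrib_left ..
    also have "\<dots> \<le> (\<Sum>k<Suc n. 2 * (c\<^sup>2 * ((1 - r\<^sup>2) * (norm e)\<^sup>2)) + 2 * (\<bar>C\<bar> * norm ((S ^^ n) u))\<^sup>2)"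
      using key n\<zeta> r by (intro sum_mono) metis
    also have "\<dots> = real (Suc n) * (2 * (c\<^sup>2 * ((1 - r\<^sup>2) * (norm e)\<^sup>2)) + 2 * (\<bar>C\<bar> * norm ((S ^^ n) u))\<^sup>2)"
      by simp
    finally show ?thesis
      by (simp only: mult_le_cancel_left_pos of_nat_0_less_iff zero_less_Suc)
  qed
  \<comment> \<open>With \<open>n\<close> fixed, letting \<open>r\<close> tend to 1 removes the term
    containing \<open>c\<close>, and the defects along the orbit of \<open>u\<close>
    telescope.\<close>
  have lim: "(norm e)\<^sup>2 - (norm (S e))\<^sup>2 + ((norm u)\<^sup>2 - (norm ((S ^^ n) u))\<^sup>2)
      \<le> 2 * (\<bar>C\<bar> * norm ((S ^^ n) u))\<^sup>2" for n
  proof -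
    have "(\<Sum>j<Suc n. 1 ^ (2 * j) * ((norm (v j))\<^sup>2 - 1\<^sup>2 * (norm (S (v j)))\<^sup>2))
      \<le> 2 * (c\<^sup>2 * ((1 - 1\<^sup>2) * (norm e)\<^sup>2)) + 2 * (\<bar>C\<bar> * norm ((S ^^ n) u))\<^sup>2"
    proof (rule tendsto_le[of "at_left 1"])
      show "at_left (1::real) \<noteq> bot" by (rule trivial_limit_at_left_real)
      show "((\<lambda>r. \<Sum>j<Suc n. r ^ (2 * j) * ((norm (v j))\<^sup>2 - r\<^sup>2 * (norm (S (v j)))\<^sup>2)) \<longlongrightarrow>
        (\<Sum>j<Suc n. 1 ^ (2 * j) * ((norm (v j))\<^sup>2 - 1\<^sup>2 * (norm (S (v j)))\<^sup>2))) (at_left 1)"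
        by (intro tendsto_intros)
      show "((\<lambda>r. 2 * (c\<^sup>2 * ((1 - r\<^sup>2) * (norm e)\<^sup>2)) + 2 * (\<bar>C\<bar> * norm ((S ^^ n) u))\<^sup>2) \<longlongrightarrow>
        2 * (c\<^sup>2 * ((1 - 1\<^sup>2) * (norm e)\<^sup>2)) + 2 * (\<bar>C\<bar> * norm ((S ^^ n) u))\<^sup>2) (at_left 1)"
        by (intro tendsto_intros)
      have "\<forall>\<^sub>F r in at_left (1::real). r \<in> {0<..<1}"
        by (rule eventually_at_left_real) simp
      then show "\<forall>\<^sub>F r in at_left 1. (\<Sum>j<Suc n. r ^ (2 * j) * ((norm (v j))\<^sup>2 - r\<^sup>2 * (norm (S (v j)))\<^sup>2))
        \<le> 2 * (c\<^sup>2 * ((1 - r\<^sup>2) * (norm e)\<^sup>2)) + 2 * (\<bar>C\<bar> * norm ((S ^^ n) u))\<^sup>2"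
        by eventually_elim (rule avg, auto)
    qed
    moreover have "(\<Sum>j<Suc n. (norm (v j))\<^sup>2 - (norm (S (v j)))\<^sup>2)
      = (norm e)\<^sup>2 - (norm (S e))\<^sup>2 + (\<Sum>k<n. (norm ((S ^^ k) u))\<^sup>2 - (norm ((S ^^ Suc k) u))\<^sup>2)"
      unfolding sum.lessThan_Suc_shift by (simp add: v_def)
    moreover have "(\<Sum>k<n. (norm ((S ^^ k) u))\<^sup>2 - (norm ((S ^^ Suc k) u))\<^sup>2)
      = (norm u)\<^sup>2 - (norm ((S ^^ n) u))\<^sup>2"
      using sum_lessThan_telescope'[of "\<lambda>k. (norm ((S ^^ k) u))\<^sup>2" n] by simp
    ultimately show ?thesis by simp
  qed
  \<comment> \<open>Now \<open>n\<close> tends to infinity, and both the truncation error and the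
    end of the telescope vanish because the orbit of \<open>u\<close> tends to 0.\<close>
  have "(norm e)\<^sup>2 - (norm (S e))\<^sup>2 + ((norm u)\<^sup>2 - (norm (0::'a))\<^sup>2) \<le> 2 * (\<bar>C\<bar> * norm (0::'a))\<^sup>2"
  proof (rule LIMSEQ_le)
    show "(\<lambda>n. (norm e)\<^sup>2 - (norm (S e))\<^sup>2 + ((norm u)\<^sup>2 - (norm ((S ^^ n) u))\<^sup>2))
      \<longlonglongrightarrow> (norm e)\<^sup>2 - (norm (S e))\<^sup>2 + ((norm u)\<^sup>2 - (norm (0::'a))\<^sup>2)"
      by (intro tendsto_intros orbit_tendsto_0[OF S C])
    show "(\<lambda>n. 2 * (\<bar>C\<bar> * norm ((S ^^ n) u))\<^sup>2) \<longlonglongrightarrow> 2 * (\<bar>C\<bar> * norm (0::'a))\<^sup>2"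
      by (intro tendsto_intros orbit_tendsto_0[OF S C])
  qed (use lim in blast)
  then have le: "(norm e)\<^sup>2 + (norm u)\<^sup>2 \<le> (norm (S e))\<^sup>2" by simp
  moreover have "(norm (S e))\<^sup>2 \<le> (norm e)\<^sup>2"
    by (intro power_mono contractionsD(2)[OF S]) simp
  ultimately have "(norm u)\<^sup>2 \<le> 0" "(norm (S e))\<^sup>2 = (norm e)\<^sup>2"
    using zero_le_power2[of "norm u"] by linarith+
  then show "norm (S e) = norm e" "S e = T e"
    by (simp_all add: u_def)
qed

lemma harnack_dominatedI:
  fixes S T :: "'a::complex_hilbert \<Rightarrow> 'a"
  assumes S: "S \<in> contractions" and T: "T \<in> contractions" and cpt: "compact_operator T"
    and C: "\<And>w y. norm w \<le> 1 \<Longrightarrow> norm y \<le> C * norm (y - w *\<^sub>C S y)"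
    and eq: "\<And>e. norm (T e) = norm e \<Longrightarrow> S e = T e"
  shows "harnack_dominated S T"
proof -
  interpret S: bounded_linear S using S contractionsD bounded_clinearD by blast
  interpret T: bounded_linear T using T contractionsD bounded_clinearD by blast
  interpret T': bounded_linear "cadjoint T"
    using cadjoint_contraction[OF T] contractionsD bounded_clinearD by blast
  obtain \<delta> where \<delta>: "\<delta> > 0" "\<And>f. (\<And>e. norm (T e) = norm e \<Longrightarrow> inner e f = 0) \<Longrightarrow>
    \<delta> * (norm f)\<^sup>2 \<le> (norm f)\<^sup>2 - (norm (T f))\<^sup>2"
    using defect_coercive_on_complement[OF T cpt] by blast
  define E where "E = op_kernel (\<lambda>x. x - cadjoint T (T x))"
  have E: "x \<in> E \<longleftrightarrow> norm (T x) = norm x" for x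
    unfolding E_def by (rule op_kernel_defect[OF T])
  have "closed E"
    unfolding E_def op_kernel_def
    by (intro closed_Collect_eq continuous_intros T'.continuous_on T.continuous_on)
  moreover have "subspace E"
    by (auto simp: E_def op_kernel_def subspace_def T.zero T.add T.scaleR T'.zero T'.add T'.scaleR)
  ultimately have proj: "\<exists>e\<in>E. \<forall>v\<in>E. inner (y - e) v = 0" for y
    using orthogonal_projection_exists[of E y] by metis
  \<comment> \<open>The 2 is the loss from the parallelogram law. The other term gives
    \<open>c * \<delta> \<ge> 8 * C\<^sup>2\<close>, which absorbs
    \<open>2 * (norm g)\<^sup>2 \<le> 8 * C\<^sup>2 * (norm f)\<^sup>2\<close>.\<close>
  define c where "c = 2 + 8 * C\<^sup>2 / \<delta>"
  have c2: "c \<ge> 2" and cC: "c * \<delta> \<ge> 8 * C\<^sup>2" using \<delta>(1) by (simp_all add: c_def field_simps)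
  have cc: "c \<le> c\<^sup>2" using c2 by (simp add: power2_eq_square)
  show ?thesis
    unfolding harnack_dominated_iff[OF S T]
  proof (intro exI[of _ c] conjI allI impI)
    fix w :: complex and x y :: 'a
    assume w: "norm w < 1" and xy: "x - w *\<^sub>C S x = y - w *\<^sub>C T y"
    obtain e where e: "e \<in> E" "\<And>v. v \<in> E \<Longrightarrow> inner (y - e) v = 0" using proj by blast
    define f where "f = y - e"
    define g where "g = x - e"
    define t where "t = (norm w)\<^sup>2"
    have t: "0 \<le> t" "t \<le> 1" using w by (auto simp: t_def power_le_one)
    have Te: "norm (T e) = norm e" "cadjoint T (T e) = e"
      using e(1) E[of e] by (simp, simp add: E_def op_kernel_def)
    \<comment> \<open>Orthogonality survives under \<open>T\<close> because
      \<open>cadjoint T (T e) = e\<close>; hence the defect form of \<open>T\<close> splits along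
      \<open>e\<close> and \<open>f\<close>.\<close>
    have ef: "inner e f = 0" "inner (T e) (T f) = 0"
    proof -
      show *: "inner e f = 0" using e by (simp add: f_def inner_commute)
      have "inner (T e) (T f) = inner f (cadjoint T (T e))"
        using inner_cadjoint[OF T, of f "T e"] by (simp add: inner_commute)
      then show "inner (T e) (T f) = 0" using * by (simp add: Te inner_commute)
    qed
    have "(norm y)\<^sup>2 = (norm e)\<^sup>2 + (norm f)\<^sup>2" "(norm (T y))\<^sup>2 = (norm e)\<^sup>2 + (norm (T f))\<^sup>2"
    proof -
      have y: "y = e + f" by (simp add: f_def)
      show "(norm y)\<^sup>2 = (norm e)\<^sup>2 + (norm f)\<^sup>2"
        unfolding y by (rule norm_add_Pythagorean) (use ef in \<open>simp add: orthogonal_def\<close>)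
      show "(norm (T y))\<^sup>2 = (norm e)\<^sup>2 + (norm (T f))\<^sup>2"
        unfolding y T.add Te(1)[symmetric]
        by (rule norm_add_Pythagorean) (use ef in \<open>simp add: orthogonal_def\<close>)
    qed
    then have qT: "(norm y)\<^sup>2 - t * (norm (T y))\<^sup>2 = (1 - t) * (norm e)\<^sup>2 + ((norm f)\<^sup>2 - t * (norm (T f))\<^sup>2)"
      by (simp add: algebra_simps)
    have "\<delta> * (norm f)\<^sup>2 \<le> (norm f)\<^sup>2 - (norm (T f))\<^sup>2"
      using e(2) E by (intro \<delta>(2)) (simp add: f_def inner_commute)
    also have "\<dots> \<le> (norm f)\<^sup>2 - t * (norm (T f))\<^sup>2"
      using t by (simp add: mult_left_le_one_le)
    finally have lower: "(1 - t) * (norm e)\<^sup>2 + \<delta> * (norm f)\<^sup>2 \<le> (norm y)\<^sup>2 - t * (norm (T y))\<^sup>2"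
      using qT by simp
    \<comment> \<open>Since \<open>S e = T e\<close>, the contributions of \<open>e\<close> cancel,
      so \<open>g\<close> is controlled by \<open>f\<close> alone.\<close>
    have "g - w *\<^sub>C S g = f - w *\<^sub>C T f"
    proof -
      have "g - w *\<^sub>C S g = (x - w *\<^sub>C S x) - (e - w *\<^sub>C S e)"
        by (simp add: g_def S.diff scaleC.diff_right)
      also have "S e = T e" using eq Te(1) .
      finally show ?thesis unfolding xy
        by (simp add: f_def T.diff scaleC.diff_right)
    qed
    then have "norm g \<le> C * norm (f - w *\<^sub>C T f)" using C[of w g] w by simp
    also have "\<dots> \<le> \<bar>C\<bar> * (norm f + norm (w *\<^sub>C T f))"
      by (intro mult_mono norm_triangle_ineq4) auto
    also have "norm (w *\<^sub>C T f) \<le> 1 * norm f"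
      unfolding norm_scaleC using w by (intro mult_mono contractionsD(2)[OF T]) auto
    finally have "norm g \<le> \<bar>C\<bar> * (norm f + 1 * norm f)" by (simp add: mult_left_mono)
    then have "(norm g)\<^sup>2 \<le> (\<bar>C\<bar> * (norm f + 1 * norm f))\<^sup>2" by (intro power_mono) auto
    then have g: "(norm g)\<^sup>2 \<le> 4 * C\<^sup>2 * (norm f)\<^sup>2" by (simp add: power_mult_distrib)
    \<comment> \<open>Nonnegativity of the form at \<open>e - g\<close> lets the parallelogram law
      bound the form at \<open>e + g\<close>.\<close>
    have q_nonneg: "t * (norm (S (e - g)))\<^sup>2 \<le> (norm (e - g))\<^sup>2"
    proof -
      have "t * (norm (S (e - g)))\<^sup>2 \<le> 1 * (norm (e - g))\<^sup>2"
        using t by (intro mult_mono power_mono contractionsD(2)[OF S]) auto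
      then show ?thesis by simp
    qed
    have Se: "norm (S e) = norm e" using eq[OF Te(1)] Te(1) by simp
    have x: "x = e + g" by (simp add: g_def)
    have "(norm x)\<^sup>2 - t * (norm (S x))\<^sup>2 \<le> 2 * ((1 - t) * (norm e)\<^sup>2) + 2 * (norm g)\<^sup>2"
    proof -
      have "(norm x)\<^sup>2 + (norm (e - g))\<^sup>2 = 2 * (norm e)\<^sup>2 + 2 * (norm g)\<^sup>2"
        unfolding x by (rule parallelogram)
      moreover have "t * (norm (S x))\<^sup>2 + t * (norm (S (e - g)))\<^sup>2
          = t * (2 * (norm e)\<^sup>2 + 2 * (norm (S g))\<^sup>2)"
        unfolding x S.add S.diff distrib_left[symmetric] parallelogram Se ..
      moreover have "t * (norm (S g))\<^sup>2 \<ge> 0" using t by simp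
      ultimately show ?thesis using q_nonneg by (simp add: algebra_simps)
    qed
    also have "\<dots> \<le> 2 * ((1 - t) * (norm e)\<^sup>2) + (8 * C\<^sup>2) * (norm f)\<^sup>2" using g by linarith
    also have "\<dots> \<le> c * ((1 - t) * (norm e)\<^sup>2) + (c * \<delta>) * (norm f)\<^sup>2"
      using c2 cC t by (intro add_mono mult_right_mono) auto
    also have "\<dots> = c * ((1 - t) * (norm e)\<^sup>2 + \<delta> * (norm f)\<^sup>2)" by (simp add: algebra_simps)
    also have "\<dots> \<le> c\<^sup>2 * ((norm y)\<^sup>2 - t * (norm (T y))\<^sup>2)"
      using cc lower t \<delta>(1) by (intro mult_mono) auto
    finally show "(norm x)\<^sup>2 - (norm w)\<^sup>2 * (norm (S x))\<^sup>2
      \<le> c\<^sup>2 * ((norm y)\<^sup>2 - (norm w)\<^sup>2 * (norm (T y))\<^sup>2)"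
      unfolding t_def .
  qed (use c2 in simp)
qed

theorem corollary2p21:
  fixes T S :: "'a::complex_hilbert \<Rightarrow> 'a"
  assumes "T \<in> contractions" and "compact_operator T"
    and "onorm T = 1" and "Gamma_p T = {}"
    and "S \<in> contractions" and "compact_operator S"
  shows "harnack_equivalent S T \<longleftrightarrow>
    op_kernel (\<lambda>x. x - cadjoint T (T x)) = op_kernel (\<lambda>x. x - cadjoint S (S x)) \<and>
    (\<forall>x \<in> op_kernel (\<lambda>x. x - cadjoint T (T x)). T x = S x)"
proof -
  note T = assms(1) and S = assms(5)
  have E_eq: "op_kernel (\<lambda>x. x - cadjoint T (T x)) = op_kernel (\<lambda>x. x - cadjoint S (S x)) \<longleftrightarrow>
    (\<forall>x. norm (T x) = norm x \<longleftrightarrow> norm (S x) = norm x)"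
    unfolding set_eq_iff op_kernel_defect[OF T] op_kernel_defect[OF S] ..
  obtain C where C: "\<And>w y. norm w \<le> 1 \<Longrightarrow> norm y \<le> C * norm (y - w *\<^sub>C T y)"
    using compact_contraction_resolvent_bound[OF T assms(2,4)] by blast
  show ?thesis
    unfolding E_eq Ball_def op_kernel_defect[OF T]
  proof
    assume "harnack_equivalent S T"
    then have ST: "harnack_dominated S T" and TS: "harnack_dominated T S"
      by (simp_all add: harnack_equivalent_def)
    \<comment> \<open>Only \<open>T\<close> is assumed to have no unimodular eigenvalues; domination
      passes this to \<open>S\<close>, which then has bounded resolvents by compactness.\<close>
    have "Gamma_p S = {}"
      by (rule harnack_dominated_imp_no_unimodular_eigenvalue[OF S T ST C])
    then obtain D where D: "\<And>w y. norm w \<le> 1 \<Longrightarrow> norm y \<le> D * norm (y - w *\<^sub>C S y)"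
      using compact_contraction_resolvent_bound[OF S assms(6)] by blast
    \<comment> \<open>Domination of \<open>S\<close> by \<open>T\<close> gives agreement on the
      vectors preserved by \<open>T\<close> and one inclusion of kernels; the reverse domination
      gives the other inclusion.\<close>
    show "(\<forall>x. norm (T x) = norm x \<longleftrightarrow> norm (S x) = norm x) \<and>
      (\<forall>x. norm (T x) = norm x \<longrightarrow> T x = S x)"
      using harnack_dominated_imp_isometric[OF S T ST D]
        harnack_dominated_imp_isometric(1)[OF T S TS C] by metis
  next
    assume eq: "(\<forall>x. norm (T x) = norm x \<longleftrightarrow> norm (S x) = norm x) \<and>
      (\<forall>x. norm (T x) = norm x \<longrightarrow> T x = S x)"
    \<comment> \<open>A unimodular eigenvector of \<open>S\<close> has its norm preserved, so
      \<open>T\<close> agrees with \<open>S\<close> there and would have the same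
      eigenvalue.\<close>
    have "Gamma_p S = {}"
    proof (rule ccontr)
      assume "Gamma_p S \<noteq> {}"
      then obtain \<mu> x where \<mu>: "norm \<mu> = 1" "x \<noteq> 0" "S x = \<mu> *\<^sub>C x"
        by (auto simp: Gamma_p_def point_spectrum_def)
      then have "norm (S x) = norm x" by (simp add: norm_scaleC)
      then have "T x = \<mu> *\<^sub>C x" using eq \<mu>(3) by metis
      then have "\<mu> \<in> Gamma_p T" using \<mu> by (auto simp: Gamma_p_def point_spectrum_def)
      with assms(4) show False by simp
    qed
    then obtain D where D: "\<And>w y. norm w \<le> 1 \<Longrightarrow> norm y \<le> D * norm (y - w *\<^sub>C S y)"
      using compact_contraction_resolvent_bound[OF S assms(6)] by blast
    show "harnack_equivalent S T"
      unfolding harnack_equivalent_def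
      using harnack_dominatedI[OF S T assms(2) D] harnack_dominatedI[OF T S assms(6) C] eq by metis
  qed
qed

end
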